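(* Every increasing Puiseux monoid is an FFM.
   Context: A Puiseux monoid is an additive submonoid $M$ of $\mathbb{Q}_{\ge 0}$. $M$ is increasing if it can be generated (as an additive monoid) by the terms of an increasing (not necessarily strictly) sequence of rationals. An element $a \in M\setminus\{0\}$ is an atom if $a = x+y$ with $x,y \in M$ implies $x=0$ or $y=0$; $M$ is atomic if each nonzero element is a (finite) sum of atoms. A factorization of $x \in M$ is a finite multiset of atoms of $M$ with sum $x$; $\mathsf{Z}(x)$ is the set of all factorizations of $x$. $M$ is an FFM (finite factorization monoid) if $M$ is atomic and $|\mathsf{Z}(x)| < \infty$ for all $x \in M$. *)

theory Defs
  imports Complex_Main "HOL-Library.Multiset"
begin

definition add_submonoid :: "'a::comm_monoid_add set \<Rightarrow> bool" where
  "add_submonoid M \<longleftrightarrow> 0 \<in> M \<and> (\<forall>x\<in>M. \<forall>y\<in>M. x + y \<in> M)"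

definition puiseux_monoid :: "rat set \<Rightarrow> bool" where
  "puiseux_monoid M \<longleftrightarrow> add_submonoid M \<and> M \<subseteq> {0..}"

text \<open>The monoid generated by \<open>S\<close> is \<open>add_submonoid hull S\<close>, the intersection of all
  additive submonoids of the ambient type that contain \<open>S\<close>.

  It suffices to use sequences indexed by \<open>nat\<close>: a nonempty finite increasing sequence can be
  prolonged by repeating its last term, and the trivial monoid is generated by the constant
  sequence 0.\<close>

definition increasing_monoid :: "rat set \<Rightarrow> bool" where
  "increasing_monoid M \<longleftrightarrow> (\<exists>r :: nat \<Rightarrow> rat. incseq r \<and> M = add_submonoid hull range r)"

definition atoms :: "'a::comm_monoid_add set \<Rightarrow> 'a set" where
  "atoms M = {a \<in> M - {0}. \<forall>x\<in>M. \<forall>y\<in>M. a = x + y \<longrightarrow> x = 0 \<or> y = 0}"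

definition factorizations :: "'a::comm_monoid_add set \<Rightarrow> 'a \<Rightarrow> 'a multiset set" where
  "factorizations M x = {F. set_mset F \<subseteq> atoms M \<and> \<Sum>\<^sub># F = x}"

definition atomic_monoid :: "'a::comm_monoid_add set \<Rightarrow> bool" where
  "atomic_monoid M \<longleftrightarrow> (\<forall>x \<in> M - {0}. \<exists>F. set_mset F \<subseteq> atoms M \<and> x = \<Sum>\<^sub># F)"

definition FFM :: "'a::comm_monoid_add set \<Rightarrow> bool" where
  "FFM M \<longleftrightarrow> atomic_monoid M \<and> (\<forall>x\<in>M. finite (factorizations M x))"

end

theory Submission
  imports Defs
begin

text \<open>Let \<open>r\<close> be an increasing sequence generating \<open>M\<close>. Every nonzero element of \<open>M\<close> is at least
  the smallest positive term \<open>m\<close> of \<open>r\<close>, so \<open>x \<in> M\<close> cannot be split into more than \<open>x / m\<close>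
  nonzero summands. Hence \<open>M\<close> is atomic and the factorizations of \<open>x\<close> have bounded length.
  All atoms are terms of \<open>r\<close>. Given infinitely many factorizations of \<open>x\<close> of the same length,
  Dickson's lemma applied to the tuples of indices yields two distinct ones that are comparable
  entry by entry; this is impossible, as they have the same sum.\<close>

text \<open>Every sequence has a monotone subsequence. If it is decreasing, well-foundedness of the
  naturals makes it constant from the point where its minimum is attained, and that tail is
  increasing as well.\<close>

lemma ex_mono_subseq_nat:
  fixes s :: "nat \<Rightarrow> nat"
  shows "\<exists>\<phi> :: nat \<Rightarrow> nat. strict_mono \<phi> \<and> mono (s \<circ> \<phi>)"
proof -
  obtain \<phi> :: "nat \<Rightarrow> nat" where \<phi>: "strict_mono \<phi>" and mon: "monoseq (\<lambda>n. s (\<phi> n))"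
    using seq_monosub[of s] by (auto simp: strict_mono_def)
  show ?thesis
  proof (cases "incseq (\<lambda>n. s (\<phi> n))")
    case True
    then show ?thesis using \<phi> by (auto simp: o_def)
  next
    case False
    then have dec: "decseq (\<lambda>n. s (\<phi> n))"
      using mon by (auto simp: monoseq_iff)
    define N where "N = arg_min (\<lambda>n. s (\<phi> n)) (\<lambda>_. True)"
    have min: "s (\<phi> N) \<le> s (\<phi> n)" for n
      unfolding N_def by (rule arg_min_nat_le) simp
    have const: "s (\<phi> (N + k)) = s (\<phi> N)" for k
      using min[of "N + k"] decseqD[OF dec, of N "N + k"] by simp
    have "strict_mono (\<lambda>k. \<phi> (N + k))"
      using \<phi> by (simp add: strict_mono_def)
    then show ?thesis
      using const by (intro exI[of _ "\<lambda>k. \<phi> (N + k)"]) (auto simp: mono_def)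
  qed
qed

text \<open>Dickson's lemma in subsequence form, with \<open>f i\<close> as the i-th coordinate. The
  sequence is thinned out once per coordinate; coordinates that are already increasing stay so along
  any further subsequence.\<close>

lemma dickson_mono_subseq:
  fixes f :: "'a \<Rightarrow> nat \<Rightarrow> nat"
  assumes "finite I"
  shows "\<exists>\<phi> :: nat \<Rightarrow> nat. strict_mono \<phi> \<and> (\<forall>i\<in>I. mono (f i \<circ> \<phi>))"
  using assms
proof (induction I)
  case empty
  show ?case using strict_mono_id by blast
next
  case (insert j I)
  then obtain \<phi> :: "nat \<Rightarrow> nat" where \<phi>: "strict_mono \<phi>" "\<forall>i\<in>I. mono (f i \<circ> \<phi>)" by blast
  obtain \<psi> :: "nat \<Rightarrow> nat" where \<psi>: "strict_mono \<psi>" "mono ((f j \<circ> \<phi>) \<circ> \<psi>)"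
    using ex_mono_subseq_nat by blast
  have "mono (f i \<circ> (\<phi> \<circ> \<psi>))" if "i \<in> insert j I" for i
    using that \<phi>(2) \<psi> by (auto simp: mono_def strict_mono_less_eq)
  moreover have "strict_mono (\<phi> \<circ> \<psi>)" using \<phi> \<psi> by (simp add: strict_mono_def)
  ultimately show ?case by blast
qed

text \<open>By cancellation, a strict inequality at one entry makes the sums differ, because the
  remaining entries cannot compensate for it.\<close>

lemma list_eq_if_le_sum_list_eq:
  fixes xs ys :: "'a::ordered_cancel_comm_monoid_add list"
  assumes "list_all2 (\<le>) xs ys" and "sum_list xs = sum_list ys"
  shows "xs = ys"
  using assms
proof (induction rule: list_all2_induct)
  case (Cons x xs y ys)
  have le: "sum_list xs \<le> sum_list ys"
    using Cons.hyps(2) by (induction rule: list_all2_induct) (auto intro: add_mono)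
  have "x = y"
    using add_less_le_mono[of x y, OF _ le] Cons.hyps(1) Cons.prems by (auto simp: order_le_less)
  then show ?case using Cons by auto
qed simp

text \<open>Lists give the entries positions, so an infinite family of them yields a sequence of
  index tuples of fixed length \<open>n\<close>, to which \<open>dickson_mono_subseq\<close>
  applies.\<close>

lemma finite_lists_sum_list_incseq:
  fixes r :: "nat \<Rightarrow> 'a::ordered_cancel_comm_monoid_add"
  assumes "incseq r"
  shows "finite {xs. set xs \<subseteq> range r \<and> length xs = n \<and> sum_list xs = x}"
    (is "finite ?S")
proof (rule ccontr)
  assume "infinite ?S"
  then obtain g :: "nat \<Rightarrow> 'a list" where g: "inj g" "range g \<subseteq> ?S"
    using infinite_countable_subset by blast
  \<comment> \<open>\<open>r\<close> may repeat values, so an index is chosen for each entry. Any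
    choice will do: a larger index always gives an entry at least as large.\<close>
  define l where "l i k = (SOME j. r j = g k ! i)" for i k
  have l: "r (l i k) = g k ! i" if "i < n" for i k
  proof -
    have "g k ! i \<in> range r" using g(2) that by (force dest: nth_mem)
    then show ?thesis unfolding l_def by (metis (mono_tags) imageE someI)
  qed
  obtain \<phi> :: "nat \<Rightarrow> nat" where \<phi>: "strict_mono \<phi>" "\<forall>i\<in>{..<n}. mono (l i \<circ> \<phi>)"
    using dickson_mono_subseq[of "{..<n}" l] by blast
  have len: "length (g k) = n" and sum: "sum_list (g k) = x" for k using g(2) by auto
  have "g (\<phi> 0) ! i \<le> g (\<phi> 1) ! i" if "i < n" for i
  proof -
    have "l i (\<phi> 0) \<le> l i (\<phi> 1)" using \<phi>(2) that by (auto simp: mono_def)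
    then show ?thesis using incseqD[OF assms] l[OF that] by metis
  qed
  then have "list_all2 (\<le>) (g (\<phi> 0)) (g (\<phi> 1))" by (simp add: list_all2_conv_all_nth len)
  then have "g (\<phi> 0) = g (\<phi> 1)"
    by (rule list_eq_if_le_sum_list_eq) (simp only: sum)
  then have "\<phi> 0 = \<phi> 1" using g(1) by (simp add: inj_eq)
  then show False using \<phi>(1) by (simp add: strict_mono_eq)
qed

text \<open>Each such multiset is the image under \<open>mset\<close> of a list with the same
  length, entries and sum.\<close>

lemma finite_msets_sum_mset_incseq:
  fixes r :: "nat \<Rightarrow> 'a::ordered_cancel_comm_monoid_add"
  assumes "incseq r"
  shows "finite {F. set_mset F \<subseteq> range r \<and> size F = n \<and> \<Sum>\<^sub># F = x}"
proof (rule finite_subset[OF _ finite_imageI[OF finite_lists_sum_list_incseq[OF assms]]])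
  show "{F. set_mset F \<subseteq> range r \<and> size F = n \<and> \<Sum>\<^sub># F = x}
      \<subseteq> mset ` {xs. set xs \<subseteq> range r \<and> length xs = n \<and> sum_list xs = x}"
  proof
    fix F assume F: "F \<in> {F. set_mset F \<subseteq> range r \<and> size F = n \<and> \<Sum>\<^sub># F = x}"
    obtain xs where xs: "F = mset xs" using ex_mset by metis
    then have "xs \<in> {xs. set xs \<subseteq> range r \<and> length xs = n \<and> sum_list xs = x}"
      using F by (simp add: sum_mset_sum_list)
    then show "F \<in> mset ` {xs. set xs \<subseteq> range r \<and> length xs = n \<and> sum_list xs = x}"
      unfolding xs by (rule imageI)
  qed
qed

text \<open>The generators together with the non-atoms of the hull form a submonoid
  \<open>?N\<close>, since a sum of two nonzero elements is never an atom. By minimality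
  \<open>?N\<close> is the whole hull.\<close>

lemma atoms_hull_subset:
  fixes S :: "'a::comm_monoid_add set"
  assumes "add_submonoid (add_submonoid hull S)"
  shows "atoms (add_submonoid hull S) \<subseteq> S"
proof -
  let ?M = "add_submonoid hull S"
  let ?N = "{x \<in> ?M. x \<in> atoms ?M \<longrightarrow> x \<in> S}"
  have "S \<subseteq> ?N" by (auto intro: hull_inc)
  moreover have "add_submonoid ?N"
    unfolding add_submonoid_def[of ?N]
  proof (intro conjI ballI)
    show "0 \<in> ?N" using assms by (simp add: add_submonoid_def[of ?M] atoms_def)
    fix x y assume xy: "x \<in> ?N" "y \<in> ?N"
    then have "x + y \<in> ?M" using assms by (simp add: add_submonoid_def[of ?M])
    moreover have "x = 0 \<or> y = 0" if "x + y \<in> atoms ?M"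
      using that xy unfolding atoms_def by blast
    ultimately show "x + y \<in> ?N" using xy by auto
  qed
  ultimately have "?M \<subseteq> ?N" by (rule hull_minimal)
  then show ?thesis unfolding atoms_def by blast
qed

text \<open>If \<open>m\<close> is the first positive term, then \<open>{0} \<union> {m..}\<close>
  contains all generators and is closed under addition, so it contains the hull.\<close>

lemma hull_incseq_bounded_away_from_0:
  fixes r :: "nat \<Rightarrow> 'a::linordered_field"
  assumes "incseq r" and nonneg: "add_submonoid hull range r \<subseteq> {0..}"
  obtains m where "m > 0" and "\<And>x. x \<in> add_submonoid hull range r - {0} \<Longrightarrow> m \<le> x"
proof -
  have r0: "0 \<le> r k" for k using nonneg hull_inc[of "r k" "range r" add_submonoid] by auto
  obtain m where m: "m > 0" "\<And>k. r k = 0 \<or> m \<le> r k"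
  proof (cases "\<exists>k. 0 < r k")
    case True
    define k where "k = (LEAST k. 0 < r k)"
    have "0 < r k" unfolding k_def using True by (rule LeastI_ex)
    moreover have "r j = 0 \<or> r k \<le> r j" for j
    proof (cases "k \<le> j")
      case True
      then show ?thesis using assms(1) by (auto dest: incseqD)
    next
      case False
      then have "\<not> 0 < r j" unfolding k_def by (intro not_less_Least) simp
      then show ?thesis using r0[of j] by simp
    qed
    ultimately show thesis using that by blast
  next
    case False
    then have "r k = 0" for k using r0[of k] by (auto simp: order_le_less)
    \<comment> \<open>All generators vanish, so any positive bound works.\<close>
    then show thesis using that[of 1] by simp
  qed
  have "add_submonoid hull range r \<subseteq> {0} \<union> {m..}"
  proof (rule hull_minimal)
    show "range r \<subseteq> {0} \<union> {m..}" using m(2) by auto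
    show "add_submonoid ({0} \<union> {m..})"
      unfolding add_submonoid_def using m(1) by auto
  qed
  then show thesis using that m(1) by blast
qed

text \<open>Induction on a bound \<open>n\<close> for \<open>x / m\<close>. In a splitting of a
  non-atom into nonzero \<open>y\<close> and \<open>z\<close>, each summand takes up at least
  \<open>m\<close>, so the other one satisfies the bound \<open>n - 1\<close>. For
  \<open>n = 0\<close> no nonzero element remains.\<close>

lemma atomic_if_bounded_away_from_0:
  fixes M :: "'a::archimedean_field set"
  assumes "m > 0" and lower: "\<And>x. x \<in> M - {0} \<Longrightarrow> m \<le> x"
  shows "atomic_monoid M"
proof -
  have "\<exists>F. set_mset F \<subseteq> atoms M \<and> x = \<Sum>\<^sub># F"
    if "x \<in> M - {0}" "x \<le> of_nat n * m" for x n
    using that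
  proof (induction n arbitrary: x)
    case 0
    then show ?case using lower[of x] assms(1) by simp
  next
    case (Suc n)
    show ?case
    proof (cases "x \<in> atoms M")
      case True
      then show ?thesis by (intro exI[of _ "{#x#}"]) simp
    next
      case False
      then obtain y z where yz: "y \<in> M - {0}" "z \<in> M - {0}" "x = y + z"
        using Suc.prems(1) unfolding atoms_def by blast
      have "y \<le> of_nat n * m" "z \<le> of_nat n * m"
        using lower[OF yz(1)] lower[OF yz(2)] yz(3) Suc.prems(2) by (simp_all add: algebra_simps)
      then obtain F G where "set_mset F \<subseteq> atoms M" "y = \<Sum>\<^sub># F" "set_mset G \<subseteq> atoms M" "z = \<Sum>\<^sub># G"
        using Suc.IH yz(1,2) by meson
      then show ?thesis using yz(3) by (intro exI[of _ "F + G"]) simp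
    qed
  qed
  moreover have "\<exists>n. x \<le> of_nat n * m" for x
    using real_arch_simple[of "x / m"] assms(1) by (simp add: pos_divide_le_eq)
  ultimately show ?thesis unfolding atomic_monoid_def by blast
qed

lemma size_mult_le_sum_mset:
  fixes F :: "'a::linordered_semidom multiset"
  assumes "\<And>a. a \<in># F \<Longrightarrow> m \<le> a"
  shows "of_nat (size F) * m \<le> \<Sum>\<^sub># F"
  using assms by (induction F) (auto simp: algebra_simps add_mono)

theorem theorem4p19:
  fixes M :: "rat set"
  assumes "puiseux_monoid M"
    and "increasing_monoid M"
  shows "FFM M"
proof -
  obtain r :: "nat \<Rightarrow> rat" where r: "incseq r" and M: "M = add_submonoid hull range r"
    using assms(2) unfolding increasing_monoid_def by blast
  have sub: "add_submonoid M" and nonneg: "M \<subseteq> {0..}"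
    using assms(1) unfolding puiseux_monoid_def by auto
  obtain m where m: "m > 0" and lower: "\<And>x. x \<in> M - {0} \<Longrightarrow> m \<le> x"
    using hull_incseq_bounded_away_from_0[OF r] nonneg unfolding M by blast
  have "finite (factorizations M x)" for x
  proof -
    obtain N :: nat where N: "x / m \<le> of_nat N" using real_arch_simple by blast
    \<comment> \<open>Each atom contributes at least \<open>m\<close> to the sum, so a factorization
      of \<open>x\<close> has at most \<open>N\<close> atoms. This leaves finitely many lengths,
      each with finitely many multisets.\<close>
    have "factorizations M x
        \<subseteq> (\<Union>n\<le>N. {F. set_mset F \<subseteq> range r \<and> size F = n \<and> \<Sum>\<^sub># F = x})"
    proof
      fix F assume F: "F \<in> factorizations M x"
      then have at: "set_mset F \<subseteq> atoms M" and sum: "\<Sum>\<^sub># F = x"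
        unfolding factorizations_def by auto
      have "of_nat (size F) * m \<le> x"
        using size_mult_le_sum_mset[of F m] lower at sum unfolding atoms_def by blast
      then have "of_nat (size F) \<le> x / m" using m by (simp add: pos_le_divide_eq)
      then have "(of_nat (size F) :: rat) \<le> of_nat N" using N by (rule order_trans)
      then have "size F \<le> N" by simp
      moreover have "set_mset F \<subseteq> range r"
        using at atoms_hull_subset sub unfolding M by blast
      ultimately show "F \<in> (\<Union>n\<le>N. {F. set_mset F \<subseteq> range r \<and> size F = n \<and> \<Sum>\<^sub># F = x})"
        using sum by simp
    qed
    then show ?thesis
      by (rule finite_subset) (simp add: finite_msets_sum_mset_incseq[OF r])
  qed
  moreover have "atomic_monoid M" using m lower by (rule atomic_if_bounded_away_from_0)
  ultimately show ?thesis unfolding FFM_def by blast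
qed

end
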